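(* Consider the noise-free system $x_{k+1}=Ax_k$, $z_k=x_k^\top Vx_k$ and the quadratic observer described in the context, under the standing assumptions listed there. Let $k\ge N+1$. With the adaptive bounds $\delta_{k,i}(x)=\zeta+L\|A^{-i}x-\hat x^Q_{k-i|k-i-1}\|^2$, where $L=\|V\|_2$ and $\zeta=0$, the true state $x_k$ belongs to the feasible set $$\mathcal F_k=\bigcap_{i=0}^N\{x\in\mathbb R^n:\ |H_{k-i}(A^{-i}x-\hat x^Q_{k-i|k-i-1})-\tilde z_{k-i}|\le\delta_{k,i}(x)\}.$$
   Context: System (noise-free). $x_{k+1}=Ax_k$, $z_k=x_k^\top Vx_k$, with $x_k\in\mathbb R^n$, $A\in\mathbb R^{n\times n}$, and $V\in\mathbb R^{n\times n}$ symmetric positive definite. $\|\cdot\|$ is the Euclidean norm, $\|V\|_2$ is the spectral norm of $V$, and $N\ge 0$ is an integer (number of past constraints). For a symmetric positive semidefinite matrix $P$, $\|v\|_P^2=v^\top Pv$. Quadratic observer. $Q\succ0$ is an $n\times n$ symmetric matrix and $\eta>0$. Start-up values $\hat x^Q_{j|j}\in\mathbb R^n$ for $0\le j\le N$ and a symmetric positive semidefinite $P^Q_{N|N}$ are given. At each time $j\ge1$ the prior is $\hat x^Q_{j|j-1}=A\hat x^Q_{j-1|j-1}$, and $H_j=(2V\hat x^Q_{j|j-1})^\top$, $\tilde z_j=z_j-(\hat x^Q_{j|j-1})^\top V\hat x^Q_{j|j-1}$. For $k\ge N+1$: $P^Q_{k|k-1}=AP^Q_{k-1|k-1}A^\top+Q$,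 $K_k=P^Q_{k|k-1}H_k^\top(H_kP^Q_{k|k-1}H_k^\top+\eta)^{-1}$, $P^Q_{k|k}=(I-K_kH_k)P^Q_{k|k-1}$, $\tilde x_{k|k}=\hat x^Q_{k|k-1}+K_k\tilde z_k$, and $\hat x^Q_{k|k}$ is a minimizer of $\|x-\tilde x_{k|k}\|^2_{(P^Q_{k|k})^{-1}}$ over $x\in\mathcal F_k$, where $\mathcal F_k$ is the set displayed in the claim. Constraint functions. For $i=0,\dots,N$, $\varphi_i^+(x)=H_{k-i}(A^{-i}x-\hat x^Q_{k-i|k-i-1})-\tilde z_{k-i}-\delta_{k,i}(x)$, $\varphi_i^-(x)=-H_{k-i}(A^{-i}x-\hat x^Q_{k-i|k-i-1})+\tilde z_{k-i}-\delta_{k,i}(x)$, $F(x)=(\varphi_0^+(x),\varphi_0^-(x),\dots,\varphi_N^+(x),\varphi_N^-(x))^\top$, $D=(-\infty,0]^{2(N+1)}$; $N_D(u)$ is the normal cone to $D$ at $u$, and $\nabla F(\bar x)^*$ is the transpose of the Jacobian. Standing assumptions. (1) $A$ is invertible. For a fixed reference point $\bar x\in\mathcal F_k$: (2) for all $i=0,\dots,N$ and $s\in\{+,-\}$, $\varphi_i^s(\bar x)=0$ implies $\nabla\varphi_i^s(\bar x)\ne0$; (3) if $y\in N_D(F(\bar x))$ and $\nabla F(\bar x)^*y=0$ then $y=0$. *)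

theory Defs
  imports "HOL-Analysis.Analysis"
begin

definition pos_semidef :: "real^'n^'n \<Rightarrow> bool" where
  "pos_semidef M \<longleftrightarrow> transpose M = M \<and> (\<forall>v. 0 \<le> v \<bullet> (M *v v))"

definition pos_def :: "real^'n^'n \<Rightarrow> bool" where
  "pos_def M \<longleftrightarrow> transpose M = M \<and> (\<forall>v. v \<noteq> 0 \<longrightarrow> 0 < v \<bullet> (M *v v))"

definition sqnorm_wrt :: "real^'n^'n \<Rightarrow> real^'n \<Rightarrow> real" where
  "sqnorm_wrt M v = v \<bullet> (M *v v)"

definition spectral_norm :: "real^'n^'m \<Rightarrow> real" where
  "spectral_norm M = onorm ((*v) M)"

text \<open>The type of matrices carries no matrix-power operation, so
  \<open>A\<^sup>-\<^sup>i x\<close> is written as the \<open>i\<close>-fold application of the inverse matrix.\<close>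

definition back_state :: "real^'n^'n \<Rightarrow> nat \<Rightarrow> real^'n \<Rightarrow> real^'n" where
  "back_state A i x = ((*v) (matrix_inv A) ^^ i) x"


text \<open>Throughout, \<open>xh j\<close> and \<open>P j\<close> are the posterior estimate and matrix with index \<open>j|j\<close>.
  The priors (index \<open>j|j-1\<close>), the rows \<open>H\<^sub>j\<close> and the innovations are meant for \<open>j \<ge> 1\<close> only.\<close>

definition prior :: "real^'n^'n \<Rightarrow> (nat \<Rightarrow> real^'n) \<Rightarrow> nat \<Rightarrow> real^'n" where
  "prior A xh j = A *v xh (j - 1)"

definition meas_row ::
  "real^'n^'n \<Rightarrow> real^'n^'n \<Rightarrow> (nat \<Rightarrow> real^'n) \<Rightarrow> nat \<Rightarrow> real^'n^1" where
  "meas_row A V xh j = rowvector (2 *\<^sub>R (V *v prior A xh j))"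

definition innov ::
  "real^'n^'n \<Rightarrow> real^'n^'n \<Rightarrow> (nat \<Rightarrow> real) \<Rightarrow> (nat \<Rightarrow> real^'n) \<Rightarrow> nat \<Rightarrow> real" where
  "innov A V z xh j = z j - prior A xh j \<bullet> (V *v prior A xh j)"

definition residual ::
  "real^'n^'n \<Rightarrow> real^'n^'n \<Rightarrow> (nat \<Rightarrow> real) \<Rightarrow> (nat \<Rightarrow> real^'n) \<Rightarrow> nat \<Rightarrow> nat \<Rightarrow> real^'n \<Rightarrow> real" where
  "residual A V z xh k i x =
     (meas_row A V xh (k - i) *v (back_state A i x - prior A xh (k - i))) $ 1 - innov A V z xh (k - i)"

definition adaptive_bound ::
  "real \<Rightarrow> real \<Rightarrow> real^'n^'n \<Rightarrow> (nat \<Rightarrow> real^'n) \<Rightarrow> nat \<Rightarrow> nat \<Rightarrow> real^'n \<Rightarrow> real" where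
  "adaptive_bound \<zeta> L A xh k i x = \<zeta> + L * (norm (back_state A i x - prior A xh (k - i)))\<^sup>2"

definition feasible_set ::
  "real^'n^'n \<Rightarrow> real^'n^'n \<Rightarrow> (nat \<Rightarrow> real) \<Rightarrow> nat \<Rightarrow> (nat \<Rightarrow> nat \<Rightarrow> real^'n \<Rightarrow> real) \<Rightarrow>
    (nat \<Rightarrow> real^'n) \<Rightarrow> nat \<Rightarrow> (real^'n) set" where
  "feasible_set A V z N \<delta> xh k = (\<Inter>i\<in>{0..N}. {x. \<bar>residual A V z xh k i x\<bar> \<le> \<delta> k i x})"

definition prior_cov ::
  "real^'n^'n \<Rightarrow> real^'n^'n \<Rightarrow> (nat \<Rightarrow> real^'n^'n) \<Rightarrow> nat \<Rightarrow> real^'n^'n" where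
  "prior_cov A Q P k = A ** P (k - 1) ** transpose A + Q"

definition gain ::
  "real^'n^'n \<Rightarrow> real^'n^'n \<Rightarrow> real^'n^'n \<Rightarrow> real \<Rightarrow> (nat \<Rightarrow> real^'n) \<Rightarrow> (nat \<Rightarrow> real^'n^'n) \<Rightarrow>
    nat \<Rightarrow> real^1^'n" where
  "gain A V Q \<eta> xh P k =
     (let H = meas_row A V xh k; R = prior_cov A Q P k
      in R ** transpose H ** matrix_inv (H ** R ** transpose H + mat \<eta>))"

definition unconstrained_est ::
  "real^'n^'n \<Rightarrow> real^'n^'n \<Rightarrow> real^'n^'n \<Rightarrow> real \<Rightarrow> (nat \<Rightarrow> real) \<Rightarrow>
    (nat \<Rightarrow> real^'n) \<Rightarrow> (nat \<Rightarrow> real^'n^'n) \<Rightarrow> nat \<Rightarrow> real^'n" where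
  "unconstrained_est A V Q \<eta> z xh P k =
     prior A xh k + gain A V Q \<eta> xh P k *v vec (innov A V z xh k)"

text \<open>The start-up values \<open>xh 0, \<dots>, xh N\<close> are arbitrary. For \<open>k > N\<close> the set over which
  \<open>xh k\<close> minimizes involves only \<open>xh j\<close> with \<open>j < k\<close>.\<close>

definition quadratic_observer ::
  "real^'n^'n \<Rightarrow> real^'n^'n \<Rightarrow> real^'n^'n \<Rightarrow> real \<Rightarrow> (nat \<Rightarrow> real) \<Rightarrow> nat \<Rightarrow>
    (nat \<Rightarrow> nat \<Rightarrow> real^'n \<Rightarrow> real) \<Rightarrow> (nat \<Rightarrow> real^'n) \<Rightarrow> (nat \<Rightarrow> real^'n^'n) \<Rightarrow> bool" where
  "quadratic_observer A V Q \<eta> z N \<delta> xh P \<longleftrightarrow>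
     pos_semidef (P N) \<and>
     (\<forall>k\<ge>N + 1.
        P k = (mat 1 - gain A V Q \<eta> xh P k ** meas_row A V xh k) ** prior_cov A Q P k \<and>
        is_arg_min (\<lambda>x. sqnorm_wrt (matrix_inv (P k)) (x - unconstrained_est A V Q \<eta> z xh P k))
          (\<lambda>x. x \<in> feasible_set A V z N \<delta> xh k) (xh k))"


definition gradient :: "('a::real_inner \<Rightarrow> real) \<Rightarrow> 'a \<Rightarrow> 'a" where
  "gradient f x = (THE d. GDERIV f x :> d)"

lemma gradient_eqI:
  assumes "GDERIV f x :> d"
  shows "gradient f x = d"
  unfolding gradient_def
proof (rule the_equality)
  fix e assume "GDERIV f x :> e"
  with assms have "(\<lambda>h. h \<bullet> e) = (\<lambda>h. h \<bullet> d)"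
    unfolding gderiv_def using has_derivative_unique by blast
  then have "(e - d) \<bullet> (e - d) = 0"
    by (metis inner_diff_right right_minus_eq)
  then show "e = d" by simp
qed (fact assms)

datatype pm = Pos | Neg

fun constraint_fun ::
  "real^'n^'n \<Rightarrow> real^'n^'n \<Rightarrow> (nat \<Rightarrow> real) \<Rightarrow> (nat \<Rightarrow> nat \<Rightarrow> real^'n \<Rightarrow> real) \<Rightarrow>
    (nat \<Rightarrow> real^'n) \<Rightarrow> nat \<Rightarrow> nat \<Rightarrow> pm \<Rightarrow> real^'n \<Rightarrow> real" where
  "constraint_fun A V z \<delta> xh k i Pos x = residual A V z xh k i x - \<delta> k i x"
| "constraint_fun A V z \<delta> xh k i Neg x = - residual A V z xh k i x - \<delta> k i x"

text \<open>Since \<open>N\<close> is a number and not a type, the space of dimension \<open>2(N+1)\<close> is represented by the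
  extensional real functions on the index set \<open>{0..N} \<times> {Pos, Neg}\<close>.\<close>

definition con_index :: "nat \<Rightarrow> (nat \<times> pm) set" where
  "con_index N = {0..N} \<times> {Pos, Neg}"

definition constraint_map ::
  "real^'n^'n \<Rightarrow> real^'n^'n \<Rightarrow> (nat \<Rightarrow> real) \<Rightarrow> nat \<Rightarrow> (nat \<Rightarrow> nat \<Rightarrow> real^'n \<Rightarrow> real) \<Rightarrow>
    (nat \<Rightarrow> real^'n) \<Rightarrow> nat \<Rightarrow> real^'n \<Rightarrow> (nat \<times> pm \<Rightarrow> real)" where
  "constraint_map A V z N \<delta> xh k x =
     (\<lambda>(i, s)\<in>con_index N. constraint_fun A V z \<delta> xh k i s x)"

definition nonpos_orthant :: "'i set \<Rightarrow> ('i \<Rightarrow> real) set" where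
  "nonpos_orthant J = J \<rightarrow>\<^sub>E {..0}"

text \<open>The normal cone of a convex set \<open>D\<close>; it is empty at points outside \<open>D\<close>.\<close>

definition normal_cone :: "'i set \<Rightarrow> ('i \<Rightarrow> real) set \<Rightarrow> ('i \<Rightarrow> real) \<Rightarrow> ('i \<Rightarrow> real) set" where
  "normal_cone J D u =
     {y \<in> J \<rightarrow>\<^sub>E UNIV. u \<in> D \<and> (\<forall>d\<in>D. (\<Sum>j\<in>J. y j * (d j - u j)) \<le> 0)}"

text \<open>The transposed Jacobian of a map \<open>F\<close> with components indexed by \<open>J\<close>; row \<open>j\<close> of the
  Jacobian is the gradient of the \<open>j\<close>-th component.\<close>

definition jacobian_adj ::
  "'i set \<Rightarrow> (real^'n \<Rightarrow> 'i \<Rightarrow> real) \<Rightarrow> real^'n \<Rightarrow> ('i \<Rightarrow> real) \<Rightarrow> real^'n" where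
  "jacobian_adj J F x y = (\<Sum>j\<in>J. y j *\<^sub>R gradient (\<lambda>x. F x j) x)"

end

theory Submission
  imports Defs
begin

text \<open>With \<open>p\<close> the prior at time \<open>j\<close> and \<open>e = x\<^sub>j - p\<close>, the measurement expands as
  \<open>z\<^sub>j = p\<^sup>T V p + 2 p\<^sup>T V e + e\<^sup>T V e\<close>. At the true state the residual is the linear term
  minus \<open>z\<^sub>j - p\<^sup>T V p\<close>, that is \<open>- e\<^sup>T V e\<close>, and
  \<open>\<bar>e\<^sup>T V e\<bar> \<le> \<parallel>V\<parallel>\<^sub>2 \<parallel>e\<parallel>\<^sup>2\<close>.\<close>

text \<open>Cauchy-Schwarz followed by the operator norm bound on \<open>M *v v\<close>. Stated with
  an absolute value, it controls a residual of either sign.\<close>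

lemma abs_quadratic_form_le_spectral_norm:
  fixes M :: "real^'n^'n"
  shows "\<bar>v \<bullet> (M *v v)\<bar> \<le> spectral_norm M * (norm v)\<^sup>2"
proof -
  have "\<bar>v \<bullet> (M *v v)\<bar> \<le> norm v * norm (M *v v)"
    by (rule Cauchy_Schwarz_ineq2)
  also have "\<dots> \<le> norm v * (onorm ((*v) M) * norm v)"
    by (intro mult_left_mono onorm matrix_vector_mul_bounded_linear norm_ge_zero)
  finally show ?thesis
    by (simp add: spectral_norm_def power2_eq_square mult_ac)
qed

lemma symmetric_form_commute:
  fixes M :: "real^'n^'n"
  assumes "transpose M = M"
  shows "u \<bullet> (M *v v) = v \<bullet> (M *v u)"
  by (metis assms dot_lmul_matrix inner_commute transpose_matrix_vector)

text \<open>Each application of the inverse undoes one step of the dynamics, so the constraint with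
  lag \<open>i\<close>, evaluated at the current state, really tests the state \<open>i\<close>
  steps earlier.\<close>

lemma back_state_trajectory:
  fixes x :: "nat \<Rightarrow> real^'n"
  assumes A: "invertible A" and state: "\<And>j. x (j + 1) = A *v x j"
  shows "back_state A i (x (j + i)) = x j"
proof (induction i)
  case 0
  show ?case by (simp add: back_state_def)
next
  case (Suc i)
  \<comment> \<open>\<open>matrix_inv\<close> is defined by choice; invertibility supplies the
    witness.\<close>
  have "matrix_inv A ** A = mat 1"
    using someI_ex[OF A[unfolded invertible_def]] by (simp add: matrix_inv_def)
  then have "matrix_inv A *v x (j + Suc i) = x (j + i)"
    using state[of "j + i"] by (simp add: matrix_vector_mul_assoc)
  \<comment> \<open>Peeling off the innermost application moves the argument to
    \<open>x (j + i)\<close>, where the induction hypothesis applies.\<close>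
  with Suc show ?case by (simp add: back_state_def funpow_Suc_right del: funpow.simps)
qed

text \<open>The residual is linearization minus measurement; for a quadratic form the Taylor
  remainder at the prior is exactly the second-order term.\<close>

lemma residual_eq_quadratic_remainder:
  fixes V :: "real^'n^'n"
  assumes sym: "transpose V = V"
    and meas: "z (k - i) = back_state A i y \<bullet> (V *v back_state A i y)"
  shows "residual A V z xh k i y =
    - ((back_state A i y - prior A xh (k - i)) \<bullet> (V *v (back_state A i y - prior A xh (k - i))))"
proof -
  define p where "p = prior A xh (k - i)"
  define e where "e = back_state A i y - p"
  have "(meas_row A V xh (k - i) *v e) $ 1 = (2 *\<^sub>R (V *v p)) \<bullet> e"
    by (simp only: meas_row_def p_def rowvector_def matrix_vector_mul_component vec_lambda_beta vec_lambda_eta)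
  also have "\<dots> = 2 * (p \<bullet> (V *v e))"
    by (simp add: symmetric_form_commute[OF sym, of p e] inner_commute)
  finally have "(meas_row A V xh (k - i) *v e) $ 1 = 2 * (p \<bullet> (V *v e))" .
  moreover have "innov A V z xh (k - i) = 2 * (p \<bullet> (V *v e)) + e \<bullet> (V *v e)"
  proof -
    have "back_state A i y = p + e" by (simp add: e_def)
    then show ?thesis
      \<comment> \<open>Symmetry merges the two cross terms of the expansion at
        \<open>p + e\<close>.\<close>
      using symmetric_form_commute[OF sym, of e p]
      by (simp add: innov_def meas inner_simps matrix_vector_right_distrib flip: p_def)
  qed
  ultimately show ?thesis
    by (simp add: residual_def flip: p_def e_def)
qed

theorem lemma1:
  fixes A V Q :: "real^'n^'n"
    and \<eta> \<zeta> L :: real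
    and N k :: nat
    and x xh :: "nat \<Rightarrow> real^'n"
    and z :: "nat \<Rightarrow> real"
    and P :: "nat \<Rightarrow> real^'n^'n"
    and \<delta> :: "nat \<Rightarrow> nat \<Rightarrow> real^'n \<Rightarrow> real"
    and xbar :: "real^'n"
  assumes V: "pos_def V" and Q: "pos_def Q" and \<eta>: "\<eta> > 0"
    and state: "\<And>j. x (j + 1) = A *v x j"
    and meas: "\<And>j. z j = x j \<bullet> (V *v x j)"
    and L: "L = spectral_norm V" and \<zeta>: "\<zeta> = 0"
    and bound: "\<delta> = adaptive_bound \<zeta> L A xh"
    and observer: "quadratic_observer A V Q \<eta> z N \<delta> xh P"
    and k: "k \<ge> N + 1"
    and A: "invertible A"
    and xbar: "xbar \<in> feasible_set A V z N \<delta> xh k"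
    and grad: "\<And>i s. \<lbrakk>i \<in> {0..N}; constraint_fun A V z \<delta> xh k i s xbar = 0\<rbrakk> \<Longrightarrow>
                 gradient (constraint_fun A V z \<delta> xh k i s) xbar \<noteq> 0"
    and qualification:
      "\<And>y. \<lbrakk>y \<in> normal_cone (con_index N) (nonpos_orthant (con_index N))
                   (constraint_map A V z N \<delta> xh k xbar);
             jacobian_adj (con_index N) (constraint_map A V z N \<delta> xh k) xbar y = 0\<rbrakk> \<Longrightarrow>
             y = (\<lambda>j\<in>con_index N. 0)"
  shows "x k \<in> feasible_set A V z N \<delta> xh k"
proof -
  have "\<bar>residual A V z xh k i (x k)\<bar> \<le> \<delta> k i (x k)" if "i \<in> {0..N}" for i
  proof -
    \<comment> \<open>Since \<open>i\<close> \<le> \<open>N\<close> < \<open>k\<close>, the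
      natural-number subtraction does not truncate.\<close>
    from that k have "k - i + i = k" by simp
    then have "back_state A i (x k) = x (k - i)"
      using back_state_trajectory[of A x i "k - i"] A state by simp
    then have "residual A V z xh k i (x k) =
        - ((x (k - i) - prior A xh (k - i)) \<bullet> (V *v (x (k - i) - prior A xh (k - i))))"
      and "\<delta> k i (x k) = spectral_norm V * (norm (x (k - i) - prior A xh (k - i)))\<^sup>2"
      using V residual_eq_quadratic_remainder[of V z k i A "x k" xh]
      by (simp_all add: pos_def_def meas bound adaptive_bound_def \<zeta> L)
    then show ?thesis
      using abs_quadratic_form_le_spectral_norm by simp
  qed
  then show ?thesis by (simp add: feasible_set_def)
qed

end
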